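(* Let $\gamma : I \to \mathbb{E}^3$ be a unit speed curve of osculating order $3$ with Bishop frame $\{T, M_1, M_2\}$ and Bishop curvatures $k_1, k_2$. If $\gamma$ is of type weak Bishop $AW(2)$, then for all $s \in I$ the equations $$\left(k_1'' - k_1^3 - k_1 k_2^2\right)\left(k_1^2 + k_2^2\right) = k_2^2\left(k_1'' - k_1^3 - k_1 k_2^2\right) - k_1 k_2\left(k_2'' - k_2^3 - k_1^2 k_2\right),$$ $$\left(k_2'' - k_2^3 - k_1^2 k_2\right)\left(k_1^2 + k_2^2\right) = k_1^2\left(k_2'' - k_2^3 - k_1^2 k_2\right) - k_1 k_2\left(k_1'' - k_1^3 - k_1 k_2^2\right)$$ hold (all functions evaluated at $s$). Moreover, a solution of these two equations is given by $$k_1(s) = -k_2(s) = \pm\frac{1}{s+c}, \qquad c \text{ a real constant},$$ that is, for either choice of sign these functions satisfy the equations wherever $s + c \neq 0$.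
   Context: $I \subset \mathbb{R}$ is an interval, $\mathbb{E}^3$ is Euclidean 3-space with inner product $\langle\cdot,\cdot\rangle$ and norm $\|\cdot\|$, curves are smooth, and primes denote derivatives with respect to the arc length parameter $s$. A unit speed curve satisfies $\|\gamma'(s)\| = 1$. It is of (osculating) order $3$ if $\gamma'(s), \gamma''(s), \gamma'''(s)$ are linearly independent for all $s$. A Bishop frame (parallel transport frame) along $\gamma$ is an orthonormal frame $\{T, M_1, M_2\}$ with $T = \gamma'$ satisfying $$T' = k_1 M_1 + k_2 M_2, \qquad M_1' = -k_1 T, \qquad M_2' = -k_2 T,$$ where the functions $k_1, k_2$ are called the first and second Bishop curvatures. Write $$\overline{N}_1 = k_1 M_1 + k_2 M_2, \qquad \overline{N}_2 = k_1' M_1 + k_2' M_2,$$ $$\overline{N}_3 = \left(k_1'' - k_1^3 - k_1 k_2^2\right) M_1 + \left(k_2'' - k_2^3 - k_1^2 k_2\right) M_2,$$ and $$\overline{N}_1^{\ast} = \frac{\overline{N}_1}{\|\overline{N}_1\|}, \qquad \overline{N}_2^{\ast} = \frac{\overline{N}_2 - \langle \overline{N}_2, \overline{N}_1^{\ast}\rangle \overline{N}_1^{\ast}}{\left\|\overline{N}_2 - \langle \overline{N}_2, \overline{N}_1^{\ast}\rangle \overline{N}_1^{\ast}\right\|}.$$ The curve is of type weak Bishop $AW(2)$ if $\overline{N}_3(s) = \langle \overline{N}_3(s), \overline{N}_2^{\ast}(s)\rangle\, \overline{N}_2^{\ast}(s)$ for all $s \in I$. *)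

theory Defs
  imports "HOL-Analysis.Analysis"
begin

text \<open>
  Derivatives of maps on an interval \<open>I\<close> are taken within \<open>I\<close>, hence are one-sided at an
  endpoint belonging to \<open>I\<close>.  They are well defined as long as \<open>I\<close> has more than one point.
\<close>

definition deriv_within :: "real set \<Rightarrow> nat \<Rightarrow> (real \<Rightarrow> 'a::real_normed_vector) \<Rightarrow> real \<Rightarrow> 'a"
  where "deriv_within I n f = ((\<lambda>g s. vector_derivative g (at s within I)) ^^ n) f"

definition smooth_within :: "real set \<Rightarrow> (real \<Rightarrow> 'a::real_normed_vector) \<Rightarrow> bool"
  where "smooth_within I f \<longleftrightarrow> (\<forall>n. deriv_within I n f differentiable_on I)"

definition proper_interval :: "real set \<Rightarrow> bool"
  where "proper_interval I \<longleftrightarrow> is_interval I \<and> interior I \<noteq> {}"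

definition unit_speed_curve :: "real set \<Rightarrow> (real \<Rightarrow> real ^ 3) \<Rightarrow> bool"
  where "unit_speed_curve I \<gamma> \<longleftrightarrow>
    smooth_within I \<gamma> \<and> (\<forall>s\<in>I. norm (deriv_within I 1 \<gamma> s) = 1)"

text \<open>
  Distinctness is required because \<open>independent\<close> is a property of sets, not of families.
\<close>

definition osculating_order_3 :: "real set \<Rightarrow> (real \<Rightarrow> real ^ 3) \<Rightarrow> bool"
  where "osculating_order_3 I \<gamma> \<longleftrightarrow>
    (\<forall>s\<in>I. distinct [deriv_within I 1 \<gamma> s, deriv_within I 2 \<gamma> s, deriv_within I 3 \<gamma> s] \<and>
           independent {deriv_within I 1 \<gamma> s, deriv_within I 2 \<gamma> s, deriv_within I 3 \<gamma> s})"

text \<open>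
  Smoothness of \<open>M1\<close>, \<open>M2\<close>, \<open>k1\<close>, \<open>k2\<close> need not be demanded separately: for smooth \<open>\<gamma>\<close> it
  follows from \<open>k\<^sub>i = \<gamma>'' \<bullet> M\<^sub>i\<close> and \<open>M\<^sub>i' = - k\<^sub>i T\<close>.
\<close>

definition bishop_frame ::
  "real set \<Rightarrow> (real \<Rightarrow> real ^ 3) \<Rightarrow> (real \<Rightarrow> real ^ 3) \<Rightarrow> (real \<Rightarrow> real ^ 3) \<Rightarrow> (real \<Rightarrow> real ^ 3) \<Rightarrow>
    (real \<Rightarrow> real) \<Rightarrow> (real \<Rightarrow> real) \<Rightarrow> bool"
  where "bishop_frame I \<gamma> T M1 M2 k1 k2 \<longleftrightarrow>
    (\<forall>s\<in>I.
       T s = deriv_within I 1 \<gamma> s \<and>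
       norm (T s) = 1 \<and> norm (M1 s) = 1 \<and> norm (M2 s) = 1 \<and>
       T s \<bullet> M1 s = 0 \<and> T s \<bullet> M2 s = 0 \<and> M1 s \<bullet> M2 s = 0 \<and>
       (T has_vector_derivative (k1 s *\<^sub>R M1 s + k2 s *\<^sub>R M2 s)) (at s within I) \<and>
       (M1 has_vector_derivative (- k1 s *\<^sub>R T s)) (at s within I) \<and>
       (M2 has_vector_derivative (- k2 s *\<^sub>R T s)) (at s within I))"

text \<open>
  With \<open>(k, l) = (k1, k2)\<close> this is the coefficient of \<open>M1\<close> in \<open>N3\<close>; the coefficient of \<open>M2\<close>
  arises by exchanging the two curvatures.
\<close>

definition N3_coeff :: "real set \<Rightarrow> (real \<Rightarrow> real) \<Rightarrow> (real \<Rightarrow> real) \<Rightarrow> real \<Rightarrow> real"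
  where "N3_coeff I k l s = deriv_within I 2 k s - k s ^ 3 - k s * l s ^ 2"

context
  fixes I :: "real set" and M1 M2 :: "real \<Rightarrow> real ^ 3" and k1 k2 :: "real \<Rightarrow> real"
begin

definition N1 :: "real \<Rightarrow> real ^ 3"
  where "N1 s = k1 s *\<^sub>R M1 s + k2 s *\<^sub>R M2 s"

definition N2 :: "real \<Rightarrow> real ^ 3"
  where "N2 s = deriv_within I 1 k1 s *\<^sub>R M1 s + deriv_within I 1 k2 s *\<^sub>R M2 s"

definition N3 :: "real \<Rightarrow> real ^ 3"
  where "N3 s = N3_coeff I k1 k2 s *\<^sub>R M1 s + N3_coeff I k2 k1 s *\<^sub>R M2 s"

definition N1_star :: "real \<Rightarrow> real ^ 3"
  where "N1_star s = N1 s /\<^sub>R norm (N1 s)"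

definition N2_star :: "real \<Rightarrow> real ^ 3"
  where "N2_star s =
    (N2 s - (N2 s \<bullet> N1_star s) *\<^sub>R N1_star s) /\<^sub>R
      norm (N2 s - (N2 s \<bullet> N1_star s) *\<^sub>R N1_star s)"

definition weak_bishop_AW2 :: bool
  where "weak_bishop_AW2 \<longleftrightarrow> (\<forall>s\<in>I. N3 s = (N3 s \<bullet> N2_star s) *\<^sub>R N2_star s)"

end

definition AW2_equations :: "real set \<Rightarrow> (real \<Rightarrow> real) \<Rightarrow> (real \<Rightarrow> real) \<Rightarrow> real \<Rightarrow> bool"
  where "AW2_equations I k1 k2 s \<longleftrightarrow>
    N3_coeff I k1 k2 s * (k1 s ^ 2 + k2 s ^ 2) =
      k2 s ^ 2 * N3_coeff I k1 k2 s - k1 s * k2 s * N3_coeff I k2 k1 s \<and>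
    N3_coeff I k2 k1 s * (k1 s ^ 2 + k2 s ^ 2) =
      k1 s ^ 2 * N3_coeff I k2 k1 s - k1 s * k2 s * N3_coeff I k1 k2 s"

end

theory Submission
  imports Defs
begin

text \<open>
  Write \<open>A\<close> and \<open>B\<close> for the coefficients of \<open>M1\<close> and \<open>M2\<close> in \<open>N3\<close>.  After cancellation the two
  equations read \<open>k1 * (A * k1 + B * k2) = 0\<close> and \<open>k2 * (A * k1 + B * k2) = 0\<close>, so both follow from
  \<open>A * k1 + B * k2 = 0\<close>, which in an orthonormal frame says that \<open>N3\<close> is orthogonal to \<open>N1\<close>.
  The Gram--Schmidt step makes \<open>N2_star\<close> orthogonal to \<open>N1\<close>, and the weak Bishop \<open>AW(2)\<close>
  condition makes \<open>N3\<close> a multiple of \<open>N2_star\<close>.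

  For the explicit solution, \<open>k = \<sigma> / (s + c)\<close> with \<open>\<sigma>\<^sup>2 = 1\<close> solves \<open>k'' = 2 * k ^ 3\<close>, and
  when the other curvature is \<open>- k\<close>, the coefficient \<open>k'' - k ^ 3 - k * (- k)\<^sup>2\<close> of \<open>N3\<close> is
  zero.  By symmetry both \<open>A\<close> and \<open>B\<close> vanish and the equations are trivial.
\<close>

lemma AW2_equations_if_N3_coeff_orthogonal:
  assumes "N3_coeff I k1 k2 s * k1 s + N3_coeff I k2 k1 s * k2 s = 0"
  shows "AW2_equations I k1 k2 s"
proof -
  let ?A = "N3_coeff I k1 k2 s" and ?B = "N3_coeff I k2 k1 s"
  have "k1 s * (?A * k1 s + ?B * k2 s) = 0" "k2 s * (?A * k1 s + ?B * k2 s) = 0"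
    by (simp_all only: assms mult_zero_right)
  then show ?thesis
    unfolding AW2_equations_def by (simp add: algebra_simps power2_eq_square)
qed

text \<open>
  Subtracting the projection onto \<open>v / |v|\<close> leaves a vector orthogonal to \<open>v\<close>; for \<open>v = 0\<close> the
  convention \<open>inverse 0 = 0\<close> makes the claim trivial.
\<close>

lemma gram_schmidt_orthogonal:
  fixes v w :: "'a::real_inner"
  shows "(w - (w \<bullet> (v /\<^sub>R norm v)) *\<^sub>R (v /\<^sub>R norm v)) \<bullet> v = 0"
proof (cases "v = 0")
  case False
  then have "(norm v)\<^sup>2 = v \<bullet> v" "norm v \<noteq> 0"
    by (simp_all add: power2_norm_eq_inner)
  then show ?thesis
    by (simp add: inner_diff_left field_simps power2_eq_square)
qed simp

lemma N2_star_orthogonal_N1: "N2_star I M1 M2 k1 k2 s \<bullet> N1 M1 M2 k1 k2 s = 0"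
  unfolding N2_star_def N1_star_def inner_scaleR_left gram_schmidt_orthogonal by simp

lemma N3_inner_N1:
  assumes "bishop_frame I \<gamma> T M1 M2 k1 k2" "s \<in> I"
  shows "N3 I M1 M2 k1 k2 s \<bullet> N1 M1 M2 k1 k2 s =
    N3_coeff I k1 k2 s * k1 s + N3_coeff I k2 k1 s * k2 s"
proof -
  have "M1 s \<bullet> M1 s = 1" "M2 s \<bullet> M2 s = 1" "M1 s \<bullet> M2 s = 0" "M2 s \<bullet> M1 s = 0"
    using assms unfolding bishop_frame_def by (auto simp: norm_eq_1 inner_commute)
  then show ?thesis
    unfolding N3_def N1_def by (simp add: inner_add_left inner_add_right)
qed

lemma weak_bishop_AW2_imp_AW2_equations:
  assumes "bishop_frame I \<gamma> T M1 M2 k1 k2" "weak_bishop_AW2 I M1 M2 k1 k2" "s \<in> I"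
  shows "AW2_equations I k1 k2 s"
proof -
  have N3: "N3 I M1 M2 k1 k2 s =
      (N3 I M1 M2 k1 k2 s \<bullet> N2_star I M1 M2 k1 k2 s) *\<^sub>R N2_star I M1 M2 k1 k2 s"
    using assms unfolding weak_bishop_AW2_def by blast
  have "N3 I M1 M2 k1 k2 s \<bullet> N1 M1 M2 k1 k2 s = 0"
    by (subst N3) (simp add: N2_star_orthogonal_N1)
  then show ?thesis
    using N3_inner_N1[OF assms(1,3)] by (simp add: AW2_equations_if_N3_coeff_orthogonal)
qed

text \<open>
  A function given by a formula only on \<open>S\<close> can be differentiated repeatedly: each derivative is
  replaced on \<open>S\<close> by a closed form \<open>g\<close> before the next one is taken.
\<close>

lemma deriv_within_Suc_open:
  assumes "open S" "s \<in> S" "\<And>t. t \<in> S \<Longrightarrow> deriv_within S n f t = g t"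
    and "(g has_vector_derivative d) (at s)"
  shows "deriv_within S (Suc n) f s = d"
proof -
  have "(deriv_within S n f has_vector_derivative d) (at s within S)"
    using has_vector_derivative_transform[OF assms(2), of "deriv_within S n f" g d] assms
    by (simp add: has_vector_derivative_at_within)
  then have "vector_derivative (deriv_within S n f) (at s within S) = d"
    by (rule vector_derivative_within[rotated]) (simp add: at_within_open[OF assms(2,1)])
  then show ?thesis
    by (simp add: deriv_within_def)
qed

lemma deriv_within_2_reciprocal:
  fixes a c :: real
  assumes k: "\<And>t. t + c \<noteq> 0 \<Longrightarrow> k t = a / (t + c)" and s: "s + c \<noteq> 0"
  shows "deriv_within {t. t + c \<noteq> 0} 2 k s = 2 * a / (s + c) ^ 3"
proof -
  have op: "open {t. t + c \<noteq> 0}"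
    by (intro open_Collect_neq continuous_intros)
  have "((\<lambda>t. a / (t + c)) has_vector_derivative - a / (t + c)\<^sup>2) (at t)" if "t + c \<noteq> 0" for t
    unfolding has_real_derivative_iff_has_vector_derivative[symmetric]
    using that by (auto intro!: derivative_eq_intros simp: power2_eq_square)
  then have first: "deriv_within {t. t + c \<noteq> 0} (Suc 0) k t = - a / (t + c)\<^sup>2"
    if "t + c \<noteq> 0" for t
    using that k by (intro deriv_within_Suc_open[OF op]) (auto simp: deriv_within_def)
  have "((\<lambda>u. - a / u\<^sup>2) has_field_derivative 2 * a / (s + c) ^ 3) (at (s + c))"
    using s
    by (auto intro!: derivative_eq_intros simp: divide_simps power2_eq_square power3_eq_cube)
  then have second: "((\<lambda>t. - a / (t + c)\<^sup>2) has_vector_derivative 2 * a / (s + c) ^ 3) (at s)"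
    unfolding has_real_derivative_iff_has_vector_derivative[symmetric] by (simp add: DERIV_shift)
  show ?thesis
    using deriv_within_Suc_open[OF op _ _ second, of "Suc 0" k] s first by (simp add: numeral_2_eq_2)
qed

lemma N3_coeff_reciprocal:
  fixes a c :: real
  assumes k: "\<And>t. t + c \<noteq> 0 \<Longrightarrow> k t = a / (t + c)" and l: "l s = - k s"
    and a: "a\<^sup>2 = 1" and s: "s + c \<noteq> 0"
  shows "N3_coeff {t. t + c \<noteq> 0} k l s = 0"
proof -
  have "a ^ 3 = a"
    using a by (simp add: power3_eq_cube power2_eq_square)
  then have "deriv_within {t. t + c \<noteq> 0} 2 k s = 2 * k s ^ 3"
    using deriv_within_2_reciprocal[of c k a s] k s by (simp add: power_divide)
  then show ?thesis
    unfolding N3_coeff_def l by (simp add: power2_eq_square power3_eq_cube)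
qed

theorem proposition4p5:
  "(\<forall>(I :: real set) (\<gamma> :: real \<Rightarrow> real ^ 3) T M1 M2 k1 k2.
      proper_interval I \<and> unit_speed_curve I \<gamma> \<and> osculating_order_3 I \<gamma> \<and>
      bishop_frame I \<gamma> T M1 M2 k1 k2 \<and> weak_bishop_AW2 I M1 M2 k1 k2
      \<longrightarrow> (\<forall>s\<in>I. AW2_equations I k1 k2 s)) \<and>
   (\<forall>(c :: real) (\<sigma> :: real) k1 k2.
      \<sigma> \<in> {1, -1} \<and> (\<forall>s. s + c \<noteq> 0 \<longrightarrow> k1 s = \<sigma> / (s + c) \<and> k2 s = - k1 s)
      \<longrightarrow> (\<forall>s. s + c \<noteq> 0 \<longrightarrow> AW2_equations {t. t + c \<noteq> 0} k1 k2 s))"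
proof (intro conjI allI impI ballI)
  fix I \<gamma> T M1 M2 k1 k2 s
  assume "proper_interval I \<and> unit_speed_curve I \<gamma> \<and> osculating_order_3 I \<gamma> \<and>
      bishop_frame I \<gamma> T M1 M2 k1 k2 \<and> weak_bishop_AW2 I M1 M2 k1 k2" and "s \<in> I"
  then show "AW2_equations I k1 k2 s"
    using weak_bishop_AW2_imp_AW2_equations by blast
next
  fix c \<sigma> :: real and k1 k2 s
  assume asm: "\<sigma> \<in> {1, -1} \<and> (\<forall>s. s + c \<noteq> 0 \<longrightarrow> k1 s = \<sigma> / (s + c) \<and> k2 s = - k1 s)"
    and s: "s + c \<noteq> 0"
  have "N3_coeff {t. t + c \<noteq> 0} k1 k2 s = 0"
    using asm s by (intro N3_coeff_reciprocal[where a = \<sigma>]) auto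
  moreover have "N3_coeff {t. t + c \<noteq> 0} k2 k1 s = 0"
    using asm s by (intro N3_coeff_reciprocal[where a = "- \<sigma>"]) auto
  ultimately show "AW2_equations {t. t + c \<noteq> 0} k1 k2 s"
    by (simp add: AW2_equations_if_N3_coeff_orthogonal)
qed

end
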